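(* Let $p\neq q$ be primes, both congruent to $5$ modulo $8$, let $N=pq$, and let $\nu=\pi_1\pi_2\in\mathbb Z[i]$ where $\pi_1$ is a primary irreducible factor of $p$ and $\pi_2$ is a primary irreducible factor of $q$ in $\mathbb Z[i]$. For an integer $m$ with $0<m<N$ and $\gcd(m,N)=1$ put $C(m)=m^2 \bmod N$, $b_0(m)=m \bmod 2$, and $b_1(m)=1$ if $\left[\frac{m}{\nu}\right]_4\in\{1,i\}$, $b_1(m)=0$ if $\left[\frac{m}{\nu}\right]_4\in\{-1,-i\}$. Then the triple $[C(m),b_0(m),b_1(m)]$ determines $m$ uniquely: among the four integers $z$ with $0<z<N$ and $z^2\equiv C(m) \bmod N$, exactly two have the parity $b_0(m)$, and of these two exactly one (namely $z=m$) satisfies $b_1(z)=b_1(m)$.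
   Context: $\mathbb Z[i]$ is the ring of Gaussian integers, with norm $\mathcal N(x+iy)=x^2+y^2$. An element $z\in\mathbb Z[i]$ is primary if $z\equiv 1 \bmod (1+i)^3$. For an irreducible $\pi\in\mathbb Z[i]$ not divisible by $1+i$ and $\alpha\in\mathbb Z[i]$, the quartic residue symbol $\left[\frac{\alpha}{\pi}\right]_4$ is $0$ if $\pi\mid\alpha$, and otherwise is the unique $i^j\in\{1,i,-1,-i\}$ with $\alpha^{(\mathcal N(\pi)-1)/4}\equiv i^j \bmod \pi$. For $\nu=\pi_1\pi_2$, $\left[\frac{\alpha}{\nu}\right]_4=\left[\frac{\alpha}{\pi_1}\right]_4\left[\frac{\alpha}{\pi_2}\right]_4$. Here $C$ is the ciphertext of a Rabin encryption of the message $m$, and $b_0,b_1$ are the two bits sent with it. *)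

theory Defs
  imports "HOL-Number_Theory.Number_Theory"
begin

section \<open>The ring of Gaussian integers\<close>

datatype gauss_int = Gauss_Int (gRe: int) (gIm: int)

lemma gauss_int_eq_iff: "z = w \<longleftrightarrow> gRe z = gRe w \<and> gIm z = gIm w"
  by (cases z; cases w) simp

instantiation gauss_int :: comm_ring_1
begin

definition zero_gauss_int :: gauss_int where "0 = Gauss_Int 0 0"

definition one_gauss_int :: gauss_int where "1 = Gauss_Int 1 0"

definition plus_gauss_int :: "gauss_int \<Rightarrow> gauss_int \<Rightarrow> gauss_int" where
  "z + w = Gauss_Int (gRe z + gRe w) (gIm z + gIm w)"

definition uminus_gauss_int :: "gauss_int \<Rightarrow> gauss_int" where
  "- z = Gauss_Int (- gRe z) (- gIm z)"

definition minus_gauss_int :: "gauss_int \<Rightarrow> gauss_int \<Rightarrow> gauss_int" where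
  "z - w = Gauss_Int (gRe z - gRe w) (gIm z - gIm w)"

definition times_gauss_int :: "gauss_int \<Rightarrow> gauss_int \<Rightarrow> gauss_int" where
  "z * w = Gauss_Int (gRe z * gRe w - gIm z * gIm w) (gRe z * gIm w + gIm z * gRe w)"

instance
  by standard
    (simp_all add: zero_gauss_int_def one_gauss_int_def plus_gauss_int_def
      uminus_gauss_int_def minus_gauss_int_def times_gauss_int_def algebra_simps)

end

lemma gauss_int_sel_simps [simp]:
  "gRe 0 = 0" "gIm 0 = 0" "gRe 1 = 1" "gIm 1 = 0"
  "gRe (z + w) = gRe z + gRe w" "gIm (z + w) = gIm z + gIm w"
  "gRe (- z) = - gRe z" "gIm (- z) = - gIm z"
  "gRe (z - w) = gRe z - gRe w" "gIm (z - w) = gIm z - gIm w"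
  "gRe (z * w) = gRe z * gRe w - gIm z * gIm w"
  "gIm (z * w) = gRe z * gIm w + gIm z * gRe w"
  by (simp_all add: zero_gauss_int_def one_gauss_int_def plus_gauss_int_def
      uminus_gauss_int_def minus_gauss_int_def times_gauss_int_def)

definition gauss_norm :: "gauss_int \<Rightarrow> int" where
  "gauss_norm z = (gRe z)\<^sup>2 + (gIm z)\<^sup>2"

lemma gauss_norm_mult: "gauss_norm (z * w) = gauss_norm z * gauss_norm w"
  by (simp add: gauss_norm_def power2_eq_square algebra_simps)

lemma gauss_norm_eq_0_iff: "gauss_norm z = 0 \<longleftrightarrow> z = 0"
  by (simp add: gauss_norm_def gauss_int_eq_iff sum_power2_eq_zero_iff)

instance gauss_int :: idom
proof
  fix z w :: gauss_int
  assume "z \<noteq> 0" "w \<noteq> 0"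
  then show "z * w \<noteq> 0"
    by (metis gauss_norm_eq_0_iff gauss_norm_mult mult_eq_0_iff)
qed

lemma gauss_of_int_eq: "of_int k = Gauss_Int k 0"
proof (induction k rule: int_induct [where k = 0])
  case base
  show ?case by (simp add: gauss_int_eq_iff)
next
  case (step1 i)
  then show ?case by (simp add: gauss_int_eq_iff)
next
  case (step2 i)
  then show ?case by (simp add: gauss_int_eq_iff)
qed

definition gauss_i :: gauss_int where "gauss_i = Gauss_Int 0 1"

lemma gauss_i_square: "gauss_i * gauss_i = - 1"
  by (simp add: gauss_i_def gauss_int_eq_iff)


section \<open>Primary elements and the quartic residue symbol\<close>

text \<open>The library's congruence relation needs Euclidean division, so congruences of Gaussian
  integers are expressed by divisibility of the difference.\<close>

definition gauss_cong :: "gauss_int \<Rightarrow> gauss_int \<Rightarrow> gauss_int \<Rightarrow> bool" where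
  "gauss_cong z w c \<longleftrightarrow> c dvd z - w"

definition primary :: "gauss_int \<Rightarrow> bool" where
  "primary z \<longleftrightarrow> gauss_cong z 1 ((1 + gauss_i) ^ 3)"

definition odd_irreducible :: "gauss_int \<Rightarrow> bool" where
  "odd_irreducible \<pi> \<longleftrightarrow> irreducible \<pi> \<and> \<not> (1 + gauss_i) dvd \<pi>"

definition quartic_symbol :: "gauss_int \<Rightarrow> gauss_int \<Rightarrow> gauss_int" where
  "quartic_symbol \<alpha> \<pi> =
     (if \<pi> dvd \<alpha> then 0
      else (THE s. s \<in> {1, gauss_i, - 1, - gauss_i} \<and>
                   gauss_cong (\<alpha> ^ nat ((gauss_norm \<pi> - 1) div 4)) s \<pi>))"

text \<open>The symbol \<open>quartic_symbol \<alpha> \<pi>\<close> is meant for \<open>odd_irreducible \<pi>\<close>. The symbol below is its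
  extension to products \<open>\<nu>\<close> of two such elements; factorizations of \<open>\<nu>\<close> agree up to order and
  units, and neither affects the product of the symbols.\<close>

definition quartic_symbol2 :: "gauss_int \<Rightarrow> gauss_int \<Rightarrow> gauss_int" where
  "quartic_symbol2 \<alpha> \<nu> =
     (THE s. \<exists>\<pi>1 \<pi>2. odd_irreducible \<pi>1 \<and> odd_irreducible \<pi>2 \<and> \<nu> = \<pi>1 * \<pi>2 \<and>
                      s = quartic_symbol \<alpha> \<pi>1 * quartic_symbol \<alpha> \<pi>2)"


section \<open>Rabin encryption with two additional bits\<close>

definition rabin_cipher :: "int \<Rightarrow> int \<Rightarrow> int" where
  "rabin_cipher N m = m\<^sup>2 mod N"

definition parity_bit :: "int \<Rightarrow> int" where
  "parity_bit m = m mod 2"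

text \<open>For \<open>m\<close> coprime to the modulus the symbol is one of the four units, so the default case
  is the one of \<open>- 1\<close> and \<open>- i\<close>.\<close>

definition quartic_bit :: "gauss_int \<Rightarrow> int \<Rightarrow> int" where
  "quartic_bit \<nu> m = (if quartic_symbol2 (of_int m) \<nu> \<in> {1, gauss_i} then 1 else 0)"

definition messages :: "int \<Rightarrow> int set" where
  "messages N = {m. 0 < m \<and> m < N \<and> coprime m N}"

definition square_roots :: "int \<Rightarrow> int \<Rightarrow> int set" where
  "square_roots N c = {z. 0 < z \<and> z < N \<and> [z\<^sup>2 = c] (mod N)}"

end

theory Submission
  imports Defs
begin

text \<open>
  Since \<open>p \<equiv> 5 (mod 8)\<close>, the prime \<open>p\<close> splits and \<open>\<N>(\<pi>\<^sub>1) = p\<close>, so the exponent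
  \<open>(p - 1) / 4\<close> in the quartic symbol is odd and the symbol of \<open>-1\<close> modulo \<open>\<pi>\<^sub>1\<close> is \<open>-1\<close>;
  likewise modulo \<open>\<pi>\<^sub>2\<close>. The square roots of \<open>m\<^sup>2\<close> modulo \<open>N\<close> are \<open>\<plusminus>m\<close> and \<open>\<plusminus>w\<close>, where
  \<open>w \<equiv> m (mod p)\<close> and \<open>w \<equiv> -m (mod q)\<close>. As \<open>N\<close> is odd, each of the two pairs contains one root
  with the parity of \<open>m\<close>. Going from \<open>m\<close> to \<open>\<plusminus>w\<close> flips the sign of exactly one of the two
  factors of the symbol modulo \<open>\<nu>\<close>, hence changes the second bit.
\<close>

section \<open>Norms, units and divisibility in the Gaussian integers\<close>

lemma gauss_norm_nonneg: "gauss_norm z \<ge> 0"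
  by (simp add: gauss_norm_def)

lemma gauss_norm_dvd: "z dvd w \<Longrightarrow> gauss_norm z dvd gauss_norm w"
  by (auto simp: gauss_norm_mult elim!: dvdE)

lemma gauss_norm_of_int: "gauss_norm (of_int k) = k\<^sup>2"
  by (simp add: gauss_norm_def gauss_of_int_eq)

lemma of_int_dvd_gauss_int_iff: "of_int k dvd z \<longleftrightarrow> k dvd gRe z \<and> k dvd gIm z"
proof
  assume "of_int k dvd z"
  then show "k dvd gRe z \<and> k dvd gIm z"
    by (auto simp: gauss_of_int_eq elim!: dvdE)
next
  assume "k dvd gRe z \<and> k dvd gIm z"
  then obtain a b where "gRe z = k * a" "gIm z = k * b"
    by (auto elim!: dvdE)
  then have "z = of_int k * Gauss_Int a b"
    by (simp add: gauss_of_int_eq gauss_int_eq_iff)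
  then show "of_int k dvd z" by simp
qed

text \<open>The second factor is the complex conjugate. It inverts elements of norm 1 and turns
  division by \<open>z\<close> into division by an integer.\<close>

lemma gauss_mult_cnj: "z * Gauss_Int (gRe z) (- gIm z) = of_int (gauss_norm z)"
  by (simp add: gauss_of_int_eq gauss_int_eq_iff gauss_norm_def power2_eq_square)

lemma gauss_unit_iff: "z dvd 1 \<longleftrightarrow> gauss_norm z = 1"
proof
  assume "z dvd 1"
  then have "gauss_norm z dvd 1"
    using gauss_norm_dvd [of z 1] by (simp add: gauss_norm_def)
  then show "gauss_norm z = 1"
    using gauss_norm_nonneg [of z] by simp
next
  assume "gauss_norm z = 1"
  then show "z dvd 1"
    using gauss_mult_cnj [of z] by (metis dvd_triv_left of_int_1)
qed

lemma mult_gauss_unit_dvd_iff: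
  fixes z w u :: gauss_int
  assumes "u dvd 1"
  shows "z * u dvd w \<longleftrightarrow> z dvd w"
proof
  assume "z * u dvd w"
  then show "z dvd w" by (rule dvd_mult_left)
next
  assume "z dvd w"
  with assms have "z * u dvd w * 1" by (intro mult_dvd_mono)
  then show "z * u dvd w" by simp
qed

section \<open>Euclidean division; irreducible Gaussian integers are prime\<close>

lemma nearest_int_multiple:
  fixes x n :: int
  assumes "n > 0"
  obtains a where "4 * (x - a * n)\<^sup>2 \<le> n\<^sup>2"
proof -
  \<comment> \<open>This is the floor of \<open>x / n + 1 / 2\<close>, so \<open>x / n\<close> is
    rounded to a nearest integer.\<close>
  define a where "a = (2 * x + n) div (2 * n)"
  define r where "r = (2 * x + n) mod (2 * n)"
  have "2 * x + n = a * (2 * n) + r"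
    unfolding a_def r_def by (rule div_mult_mod_eq [symmetric])
  then have "2 * (x - a * n) = r - n"
    by (simp add: algebra_simps)
  moreover have "0 \<le> r" "r < 2 * n"
    using assms by (simp_all add: r_def)
  ultimately have "\<bar>2 * (x - a * n)\<bar> \<le> \<bar>n\<bar>"
    by linarith
  then have "(2 * (x - a * n))\<^sup>2 \<le> n\<^sup>2"
    by (simp only: abs_le_square_iff)
  then show ?thesis
    using that [of a] unfolding power_mult_distrib by simp
qed

text \<open>The exact quotient is \<open>\<alpha> * \<beta>'\<close> divided by \<open>n\<close>,
  where \<open>\<beta>'\<close> is the conjugate of \<open>\<beta>\<close>. Rounding both
  coordinates leaves errors of at most 1/2, so the remainder has at most half the norm of
  \<open>\<beta>\<close>.\<close>

lemma gauss_division: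
  assumes "\<beta> \<noteq> 0"
  obtains \<kappa> where "gauss_norm (\<alpha> - \<kappa> * \<beta>) < gauss_norm \<beta>"
proof -
  define n where "n = gauss_norm \<beta>"
  define \<beta>' where "\<beta>' = Gauss_Int (gRe \<beta>) (- gIm \<beta>)"
  have n: "n > 0"
    using assms gauss_norm_nonneg [of \<beta>] gauss_norm_eq_0_iff [of \<beta>] by (simp add: n_def)
  obtain a where a: "4 * (gRe (\<alpha> * \<beta>') - a * n)\<^sup>2 \<le> n\<^sup>2"
    using nearest_int_multiple [OF n] .
  obtain b where b: "4 * (gIm (\<alpha> * \<beta>') - b * n)\<^sup>2 \<le> n\<^sup>2"
    using nearest_int_multiple [OF n] .
  define \<kappa> where "\<kappa> = Gauss_Int a b"
  have "(\<alpha> - \<kappa> * \<beta>) * \<beta>' = \<alpha> * \<beta>' - \<kappa> * of_int n"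
    using gauss_mult_cnj [of \<beta>] by (simp add: n_def \<beta>'_def algebra_simps)
  then have "gauss_norm (\<alpha> - \<kappa> * \<beta>) * gauss_norm \<beta>' = gauss_norm (\<alpha> * \<beta>' - \<kappa> * of_int n)"
    by (metis gauss_norm_mult)
  moreover have "gauss_norm (\<alpha> * \<beta>' - \<kappa> * of_int n)
      = (gRe (\<alpha> * \<beta>') - a * n)\<^sup>2 + (gIm (\<alpha> * \<beta>') - b * n)\<^sup>2"
    by (simp add: gauss_norm_def \<kappa>_def gauss_of_int_eq)
  moreover have "gauss_norm \<beta>' = n"
    by (simp add: n_def \<beta>'_def gauss_norm_def)
  ultimately have "4 * (gauss_norm (\<alpha> - \<kappa> * \<beta>) * n) \<le> 2 * n\<^sup>2"
    using a b by simp
  also have "\<dots> < 4 * n\<^sup>2" using n by simp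
  finally have "gauss_norm (\<alpha> - \<kappa> * \<beta>) < n"
    using n by (simp add: power2_eq_square)
  then show ?thesis
    using that by (simp add: n_def)
qed

text \<open>A nonzero element of minimal norm in the ideal generated by \<open>\<pi>\<close> and \<open>\<alpha>\<close> divides both
  generators, so it is a unit.\<close>

lemma irreducible_gauss_bezout:
  fixes \<pi> \<alpha> :: gauss_int
  assumes irr: "irreducible \<pi>" and ndvd: "\<not> \<pi> dvd \<alpha>"
  obtains u v where "u * \<pi> + v * \<alpha> = 1"
proof -
  define I where "I = {u * \<pi> + v * \<alpha> |u v. True}"
  have comb: "\<exists>u v. z = u * \<pi> + v * \<alpha>" if "z \<in> I" for z
    using that by (auto simp: I_def)
  have "\<pi> = 1 * \<pi> + 0 * \<alpha>" by simp
  then have \<pi>I: "\<pi> \<in> I" unfolding I_def by blast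
  have "\<alpha> = 0 * \<pi> + 1 * \<alpha>" by simp
  then have \<alpha>I: "\<alpha> \<in> I" unfolding I_def by blast
  have diffI: "z - k * w \<in> I" if zw: "z \<in> I" "w \<in> I" for z w k
  proof -
    obtain u v u' v' where "z = u * \<pi> + v * \<alpha>" "w = u' * \<pi> + v' * \<alpha>"
      using comb zw by metis
    then have "z - k * w = (u - k * u') * \<pi> + (v - k * v') * \<alpha>"
      by (simp add: algebra_simps)
    then show ?thesis unfolding I_def by blast
  qed
  have "\<pi> \<in> I \<and> \<pi> \<noteq> 0" using \<pi>I irr by auto
  then obtain d where d: "d \<in> I" "d \<noteq> 0"
    and dmin: "\<And>z. z \<in> I \<Longrightarrow> z \<noteq> 0 \<Longrightarrow> nat (gauss_norm d) \<le> nat (gauss_norm z)"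
    using ex_has_least_nat [of "\<lambda>z. z \<in> I \<and> z \<noteq> 0" \<pi> "\<lambda>z. nat (gauss_norm z)"] by blast
  have ddvd: "d dvd z" if z: "z \<in> I" for z
  proof -
    obtain k where k: "gauss_norm (z - k * d) < gauss_norm d"
      using gauss_division [OF d(2)] .
    then have "z - k * d = 0"
      using dmin [OF diffI [OF z d(1)], of k] gauss_norm_nonneg [of "z - k * d"]
      by linarith
    then show ?thesis by simp
  qed
  from ddvd [OF \<pi>I] obtain e where e: "\<pi> = d * e" by (elim dvdE)
  \<comment> \<open>If \<open>e\<close> were a unit, \<open>\<pi>\<close> would divide
    \<open>d\<close> and hence \<open>\<alpha>\<close>. So in the factorization
    \<open>\<pi> = d * e\<close> it is \<open>d\<close> that must be a unit.\<close>
  have "\<not> e dvd 1"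
  proof
    assume "e dvd 1"
    then have "\<pi> dvd d"
      unfolding e by (simp add: mult_gauss_unit_dvd_iff)
    with ddvd [OF \<alpha>I] ndvd show False by (blast intro: dvd_trans)
  qed
  with irreducibleD [OF irr e] have "d dvd 1" by blast
  then obtain c where c: "1 = d * c" by (elim dvdE)
  obtain u v where "d = u * \<pi> + v * \<alpha>" using comb d(1) by blast
  with c have "(c * u) * \<pi> + (c * v) * \<alpha> = 1" by (simp add: algebra_simps)
  then show ?thesis using that by blast
qed

text \<open>Multiplying a Bezout relation for \<open>\<pi>\<close> and \<open>\<beta>\<close> by
  \<open>\<alpha>\<close> writes \<open>\<alpha>\<close> as a sum of two multiples of
  \<open>\<pi>\<close>.\<close>

lemma irreducible_gauss_dvd_mult:
  fixes \<pi> :: gauss_int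
  assumes irr: "irreducible \<pi>" and dvd: "\<pi> dvd \<alpha> * \<beta>"
  shows "\<pi> dvd \<alpha> \<or> \<pi> dvd \<beta>"
proof (rule disjCI)
  assume "\<not> \<pi> dvd \<beta>"
  then obtain u v where "u * \<pi> + v * \<beta> = 1"
    using irreducible_gauss_bezout [OF irr] by blast
  then have "\<alpha> = \<alpha> * u * \<pi> + v * (\<alpha> * \<beta>)"
    by (metis (no_types, lifting) distrib_left mult.assoc mult.left_commute mult.right_neutral)
  then show "\<pi> dvd \<alpha>" using dvd by (metis dvd_add dvd_mult dvd_triv_right)
qed

section \<open>Primes congruent to 5 modulo 8 and the norms of their Gaussian factors\<close>

text \<open>The square is \<open>m\<close> to the power \<open>(p - 1) / 2\<close>, which Euler's
  criterion identifies modulo \<open>p\<close> with the Legendre symbol, that is, with 1 or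
  -1.\<close>

lemma square_cong_plus_minus_one:
  fixes p m :: int
  assumes p: "prime p" "[p = 5] (mod 8)" and m: "\<not> p dvd m"
  shows "p dvd (m ^ nat ((p - 1) div 4))\<^sup>2 - 1 \<or> p dvd (m ^ nat ((p - 1) div 4))\<^sup>2 + 1"
proof -
  define P where "P = nat p"
  have P: "p = int P" using prime_gt_0_int [OF p(1)] by (simp add: P_def)
  have mod8: "p mod 8 = 5" using p(2) by (simp add: cong_def)
  then have "P mod 8 = 5" unfolding P by presburger
  \<comment> \<open>\<open>P - 1\<close> is a multiple of 4, so neither division rounds.\<close>
  then have "(P - 1) div 2 = (P - 1) div 4 * 2"
    by presburger
  moreover have "nat ((p - 1) div 4) = (P - 1) div 4"
    using \<open>P mod 8 = 5\<close> unfolding P by (cases P) (simp_all add: nat_div_distrib)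
  ultimately have half: "(P - 1) div 2 = nat ((p - 1) div 4) * 2"
    by simp
  have "P > 2" using \<open>P mod 8 = 5\<close> by (cases "P \<le> 2") auto
  moreover have "prime P" using p(1) P by simp
  ultimately have "[Legendre m p = m ^ ((P - 1) div 2)] (mod p)"
    using euler_criterion [of P m] P by simp
  then have "p dvd (m ^ nat ((p - 1) div 4))\<^sup>2 - Legendre m p"
    unfolding half power_mult by (simp add: cong_iff_dvd_diff dvd_diff_commute)
  moreover have "Legendre m p = 1 \<or> Legendre m p = - 1"
    using m by (auto simp: Legendre_def cong_0_iff)
  ultimately show ?thesis by auto
qed

text \<open>Since \<open>(p - 1) / 2\<close> is even, Euler's criterion gives -1 the Legendre symbol
  1.\<close>

lemma minus_one_square_mod:
  fixes p :: int
  assumes p: "prime p" "[p = 5] (mod 8)"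
  shows "\<exists>x. p dvd x\<^sup>2 + 1"
proof -
  define P where "P = nat p"
  have P: "p = int P" using prime_gt_0_int [OF p(1)] by (simp add: P_def)
  have mod8: "p mod 8 = 5" using p(2) by (simp add: cong_def)
  then have P5: "P mod 8 = 5" unfolding P by presburger
  then have half: "even ((P - 1) div 2)"
    by presburger
  have "P > 2" using \<open>P mod 8 = 5\<close> by (cases "P \<le> 2") auto
  moreover have "prime P" using p(1) P by simp
  ultimately have "[Legendre (- 1) p = (- 1) ^ ((P - 1) div 2)] (mod p)"
    using euler_criterion [of P "-1"] P by simp
  then have cong: "[Legendre (- 1) p = 1] (mod p)"
    using half by simp
  have "QuadRes p (- 1)"
  proof (rule ccontr)
    assume "\<not> QuadRes p (- 1)"
    then have "p dvd Legendre (- 1) p - 1 \<and> (Legendre (- 1) p = 0 \<or> Legendre (- 1) p = - 1)"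
      using cong by (auto simp: Legendre_def cong_iff_dvd_diff)
    then have "p dvd 1 \<or> p dvd 2" by auto
    then have "p \<le> 2" by (auto dest: zdvd_imp_le)
    with \<open>P > 2\<close> P show False by simp
  qed
  then show ?thesis by (auto simp: QuadRes_def cong_iff_dvd_diff)
qed

text \<open>The norm divides \<open>p\<^sup>2\<close>, so it is 1, \<open>p\<close> or
  \<open>p\<^sup>2\<close>. It is not 1 because \<open>\<pi>\<close> is no unit;
  \<open>p\<^sup>2\<close> would make \<open>p\<close> an associate of \<open>\<pi>\<close>, hence a
  prime element.\<close>

lemma gauss_norm_prime_factor:
  fixes p :: int
  assumes p: "prime p" "[p = 5] (mod 8)" and irr: "irreducible \<pi>" and dvd: "\<pi> dvd of_int p"
  shows "gauss_norm \<pi> = p"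
proof -
  obtain c where c: "of_int p = \<pi> * c" using dvd by (elim dvdE)
  have norm: "gauss_norm \<pi> * gauss_norm c = p\<^sup>2"
    using gauss_norm_of_int [of p] by (simp add: c gauss_norm_mult)
  have "\<not> \<pi> dvd 1" using irr by (simp add: irreducible_def)
  then have \<pi>1: "gauss_norm \<pi> \<noteq> 1" by (simp add: gauss_unit_iff)
  have p_gt: "p > 1" using p(1) by (rule prime_gt_1_int)
  have c1: "gauss_norm c \<noteq> 1"
  proof
    assume "gauss_norm c = 1"
    then have "c dvd 1" by (simp add: gauss_unit_iff)
    then have p\<pi>: "of_int p dvd \<pi>" by (simp add: c mult_gauss_unit_dvd_iff)
    \<comment> \<open>\<open>p\<close> divides \<open>x\<^sup>2 + 1\<close>, the product of
      \<open>x + i\<close> and \<open>x - i\<close>, but neither factor, as their imaginary parts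
      are 1 and -1.\<close>
    obtain x where x: "p dvd x\<^sup>2 + 1" using minus_one_square_mod [OF p] by blast
    have "(of_int p :: gauss_int) dvd of_int (x\<^sup>2 + 1)"
      using x by (metis dvd_def of_int_mult)
    then have "\<pi> dvd Gauss_Int x 1 * Gauss_Int x (- 1)"
      using dvd by (auto simp: gauss_of_int_eq times_gauss_int_def power2_eq_square
          intro: dvd_trans)
    then have "\<pi> dvd Gauss_Int x 1 \<or> \<pi> dvd Gauss_Int x (- 1)"
      by (rule irreducible_gauss_dvd_mult [OF irr])
    then have "of_int p dvd Gauss_Int x 1 \<or> of_int p dvd Gauss_Int x (- 1)"
      using p\<pi> by (blast intro: dvd_trans)
    then have "p dvd 1" by (auto simp: of_int_dvd_gauss_int_iff)
    with p_gt show False by simp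
  qed
  have "gauss_norm \<pi> dvd p\<^sup>2" using norm by (metis dvd_triv_left)
  then obtain k where k: "k \<le> 2" "gauss_norm \<pi> = p ^ k"
    using divides_primepow [OF p(1), of "gauss_norm \<pi>" 2] gauss_norm_nonneg [of \<pi>]
    by (auto simp: abs_of_nonneg)
  have "k \<noteq> 0" using k \<pi>1 by (cases "k = 0") auto
  moreover have "k \<noteq> 2" using k c1 norm p_gt by auto
  ultimately show ?thesis using k by (cases "k = 1") auto
qed

lemma odd_prime_not_dvd_two:
  fixes p :: int
  assumes "prime p" "odd p"
  shows "\<not> p dvd 2"
proof
  assume "p dvd 2"
  then have "p \<le> 2" by (rule zdvd_imp_le) simp
  with prime_gt_1_int [OF assms(1)] assms(2) show False by (cases "p = 2") auto
qed

section \<open>The quartic symbol of a rational integer modulo a factor of \<open>p\<close>\<close>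

definition gauss_units :: "gauss_int set" where
  "gauss_units = {1, gauss_i, - 1, - gauss_i}"

text \<open>Distinct units differ by an element of norm 2 or 4, which the odd prime \<open>p\<close>
  cannot divide. This gives uniqueness of the value of the quartic symbol.\<close>

lemma gauss_units_cong_eq:
  fixes p :: int
  assumes "prime p" "odd p" "gauss_norm \<pi> = p" "s \<in> gauss_units" "t \<in> gauss_units"
    and "\<pi> dvd s - t"
  shows "s = t"
proof -
  have "p dvd gauss_norm (s - t)"
    using gauss_norm_dvd [OF assms(6)] assms(3) by simp
  moreover have "gauss_norm (s - t) \<in> {2, 4} \<or> s = t"
    using assms(4,5) by (auto simp: gauss_units_def gauss_norm_def gauss_i_def)
  moreover have "\<not> p dvd 2"
    by (rule odd_prime_not_dvd_two [OF assms(1,2)])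
  moreover from this have "\<not> p dvd 4"
    using prime_dvd_multD [OF assms(1), of 2 2] by auto
  ultimately show ?thesis by auto
qed

lemma odd_of_cong_5_mod_8:
  fixes p :: int
  assumes "[p = 5] (mod 8)"
  shows "odd p"
proof -
  have "p mod 8 = 5" using assms by (simp add: cong_def)
  then show ?thesis by presburger
qed

text \<open>Replaces the definite description by a usable criterion, once existence and uniqueness
  of the unit are known.\<close>

lemma quartic_symbol_eq_iff:
  fixes p m :: int
  assumes p: "prime p" "[p = 5] (mod 8)" and irr: "irreducible \<pi>" and dvd: "\<pi> dvd of_int p"
    and m: "\<not> p dvd m"
  shows "quartic_symbol (of_int m) \<pi> = s \<longleftrightarrow>
    s \<in> gauss_units \<and> \<pi> dvd of_int (m ^ nat ((p - 1) div 4)) - s"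
proof -
  define x where "x = m ^ nat ((p - 1) div 4)"
  define X :: gauss_int where "X = of_int x"
  have norm: "gauss_norm \<pi> = p" by (rule gauss_norm_prime_factor [OF p irr dvd])
  have "odd p" using p(2) by (rule odd_of_cong_5_mod_8)
  have "\<not> \<pi> dvd of_int m"
  proof
    assume "\<pi> dvd of_int m"
    then have "p dvd m\<^sup>2"
      using gauss_norm_dvd [of \<pi> "of_int m"] norm by (simp add: gauss_norm_of_int)
    with m p(1) show False by (simp add: prime_dvd_power_iff)
  qed
  then have symbol: "quartic_symbol (of_int m) \<pi> = (THE s. s \<in> gauss_units \<and> \<pi> dvd X - s)"
    by (simp add: quartic_symbol_def gauss_units_def gauss_cong_def norm X_def x_def)
  have "\<exists>s. s \<in> gauss_units \<and> \<pi> dvd X - s"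
  proof -
    have mono: "\<pi> dvd of_int k" if "p dvd k" for k
      using that dvd by (metis dvd_def dvd_mult2 of_int_mult)
    \<comment> \<open>The power \<open>X\<close> squares to 1 or -1 modulo \<open>\<pi>\<close>.
      Both \<open>X\<^sup>2 - 1\<close> and \<open>X\<^sup>2 + 1\<close> split into linear factors
      \<open>X - s\<close> with \<open>s\<close> a unit, and the prime element \<open>\<pi>\<close>
      divides one of them.\<close>
    from square_cong_plus_minus_one [OF p m]
    have "\<pi> dvd of_int (x\<^sup>2 - 1) \<or> \<pi> dvd of_int (x\<^sup>2 + 1)"
      unfolding x_def [symmetric] using mono by blast
    moreover have "of_int (x\<^sup>2 - 1) = (X - 1) * (X - (- 1))"
      by (simp add: X_def algebra_simps power2_eq_square)
    moreover have "of_int (x\<^sup>2 + 1) = (X - gauss_i) * (X - (- gauss_i))"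
      by (simp add: X_def gauss_of_int_eq gauss_i_def gauss_int_eq_iff power2_eq_square)
    ultimately show ?thesis
      unfolding gauss_units_def using irreducible_gauss_dvd_mult [OF irr] by (metis insertCI)
  qed
  then obtain s0 where s0: "s0 \<in> gauss_units" "\<pi> dvd X - s0" by blast
  have uniq: "t = s0" if "t \<in> gauss_units" "\<pi> dvd X - t" for t
  proof -
    have "\<pi> dvd (X - s0) - (X - t)" using s0(2) that(2) by (rule dvd_diff)
    then have "\<pi> dvd t - s0" by simp
    then show ?thesis
      using gauss_units_cong_eq [OF p(1) \<open>odd p\<close> norm that(1) s0(1)] by blast
  qed
  have "quartic_symbol (of_int m) \<pi> = s0"
    unfolding symbol by (rule the_equality) (use s0 uniq in blast)+
  then show ?thesis
    using s0 uniq unfolding X_def x_def by metis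
qed

lemma quartic_symbol_cong:
  fixes p m n :: int
  assumes p: "prime p" "[p = 5] (mod 8)" and irr: "irreducible \<pi>" and dvd: "\<pi> dvd of_int p"
    and m: "\<not> p dvd m" and mn: "[n = m] (mod p)"
  shows "quartic_symbol (of_int n) \<pi> = quartic_symbol (of_int m) \<pi>"
proof -
  let ?k = "nat ((p - 1) div 4)"
  let ?s = "quartic_symbol (of_int m) \<pi>"
  have n: "\<not> p dvd n" using m mn by (simp add: cong_dvd_iff)
  have s: "?s \<in> gauss_units" "\<pi> dvd of_int (m ^ ?k) - ?s"
    using quartic_symbol_eq_iff [OF p irr dvd m] by blast+
  have "[n ^ ?k = m ^ ?k] (mod p)" using mn by (rule cong_pow)
  then have "p dvd n ^ ?k - m ^ ?k" by (simp add: cong_iff_dvd_diff)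
  then have "\<pi> dvd of_int (n ^ ?k - m ^ ?k)"
    using dvd by (metis dvd_def dvd_mult2 of_int_mult)
  from dvd_add [OF this s(2)] have "\<pi> dvd of_int (n ^ ?k) - ?s" by simp
  with s(1) show ?thesis using quartic_symbol_eq_iff [OF p irr dvd n] by blast
qed

lemma quartic_symbol_uminus:
  fixes p m :: int
  assumes p: "prime p" "[p = 5] (mod 8)" and irr: "irreducible \<pi>" and dvd: "\<pi> dvd of_int p"
    and m: "\<not> p dvd m"
  shows "quartic_symbol (of_int (- m)) \<pi> = - quartic_symbol (of_int m) \<pi>"
proof -
  let ?k = "nat ((p - 1) div 4)"
  let ?s = "quartic_symbol (of_int m) \<pi>"
  have s: "?s \<in> gauss_units" "\<pi> dvd of_int (m ^ ?k) - ?s"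
    using quartic_symbol_eq_iff [OF p irr dvd m] by blast+
  have "p mod 8 = 5" using p(2) by (simp add: cong_def)
  \<comment> \<open>The residue 5 modulo 8 makes the exponent odd, so the sign passes through the
    power.\<close>
  then have "odd ((p - 1) div 4)" "(p - 1) div 4 \<ge> 0"
    using prime_gt_1_int [OF p(1)] by presburger+
  then have "odd ?k" by (simp add: even_nat_iff)
  then have "of_int ((- m) ^ ?k) - (- ?s) = - (of_int (m ^ ?k) - ?s)" by simp
  then have "\<pi> dvd of_int ((- m) ^ ?k) - (- ?s)"
    using s(2) by (simp only: dvd_minus_iff)
  moreover have "- ?s \<in> gauss_units" using s(1) by (auto simp: gauss_units_def)
  moreover have "\<not> p dvd - m" using m by simp
  ultimately show ?thesis using quartic_symbol_eq_iff [OF p irr dvd] by blast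
qed

section \<open>The symbol modulo a product of two irreducibles\<close>

text \<open>Associates have the same multiples and the same norm, and the symbol depends on
  \<open>\<pi>\<close> only through these.\<close>

lemma quartic_symbol_unit_mult:
  assumes "u dvd 1"
  shows "quartic_symbol \<alpha> (\<pi> * u) = quartic_symbol \<alpha> \<pi>"
proof -
  have "gauss_norm u = 1" using assms by (simp add: gauss_unit_iff)
  then show ?thesis
    using assms by (simp add: quartic_symbol_def gauss_cong_def gauss_norm_mult mult_gauss_unit_dvd_iff)
qed

text \<open>Shows that the definite description is well defined: as \<open>\<pi>1\<close> is a prime
  element, any other factorization agrees with the given one up to order and units.\<close>

lemma quartic_symbol2_mult:
  assumes \<pi>: "odd_irreducible \<pi>1" "odd_irreducible \<pi>2"
  shows "quartic_symbol2 \<alpha> (\<pi>1 * \<pi>2) = quartic_symbol \<alpha> \<pi>1 * quartic_symbol \<alpha> \<pi>2"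
  unfolding quartic_symbol2_def
proof (rule the_equality)
  show "\<exists>\<rho>1 \<rho>2. odd_irreducible \<rho>1 \<and> odd_irreducible \<rho>2 \<and> \<pi>1 * \<pi>2 = \<rho>1 * \<rho>2 \<and>
      quartic_symbol \<alpha> \<pi>1 * quartic_symbol \<alpha> \<pi>2 = quartic_symbol \<alpha> \<rho>1 * quartic_symbol \<alpha> \<rho>2"
    using \<pi> by blast
next
  \<comment> \<open>This treats \<open>\<pi>1\<close> dividing the first factor; exchanging
    \<open>\<rho>1\<close> and \<open>\<rho>2\<close> gives the other case.\<close>
  have main: "quartic_symbol \<alpha> \<rho>1 * quartic_symbol \<alpha> \<rho>2 = quartic_symbol \<alpha> \<pi>1 * quartic_symbol \<alpha> \<pi>2"
    if \<rho>: "odd_irreducible \<rho>1" and eq: "\<pi>1 * \<pi>2 = \<rho>1 * \<rho>2" and dvd: "\<pi>1 dvd \<rho>1" for \<rho>1 \<rho>2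
  proof -
    obtain u where u: "\<rho>1 = \<pi>1 * u" using dvd by (elim dvdE)
    have "\<not> \<pi>1 dvd 1" "\<pi>1 \<noteq> 0" using \<pi>(1) by (auto simp: odd_irreducible_def irreducible_def)
    moreover have "irreducible \<rho>1" using \<rho> by (simp add: odd_irreducible_def)
    ultimately have unit: "u dvd 1" using irreducibleD u by blast
    \<comment> \<open>Cancelling \<open>\<pi>1\<close> shows that the second factors are associates
      as well.\<close>
    have "\<pi>2 = \<rho>2 * u" using eq u \<open>\<pi>1 \<noteq> 0\<close> by (simp add: mult.assoc mult.commute)
    then show ?thesis using u unit by (simp add: quartic_symbol_unit_mult)
  qed
  fix s
  assume "\<exists>\<rho>1 \<rho>2. odd_irreducible \<rho>1 \<and> odd_irreducible \<rho>2 \<and> \<pi>1 * \<pi>2 = \<rho>1 * \<rho>2 \<and>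
      s = quartic_symbol \<alpha> \<rho>1 * quartic_symbol \<alpha> \<rho>2"
  then obtain \<rho>1 \<rho>2 where \<rho>: "odd_irreducible \<rho>1" "odd_irreducible \<rho>2"
    and eq: "\<pi>1 * \<pi>2 = \<rho>1 * \<rho>2" and s: "s = quartic_symbol \<alpha> \<rho>1 * quartic_symbol \<alpha> \<rho>2"
    by blast
  have "\<pi>1 dvd \<rho>1 * \<rho>2" by (simp flip: eq)
  then have "\<pi>1 dvd \<rho>1 \<or> \<pi>1 dvd \<rho>2"
    using \<pi>(1) irreducible_gauss_dvd_mult by (auto simp: odd_irreducible_def)
  then show "s = quartic_symbol \<alpha> \<pi>1 * quartic_symbol \<alpha> \<pi>2"
    using main [of \<rho>1 \<rho>2] main [of \<rho>2 \<rho>1] \<rho> eq s by (auto simp: mult.commute)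
qed

text \<open>\<open>1 + gauss_i\<close> has norm 2, which does not divide the odd norm
  \<open>p\<close> of \<open>\<pi>\<close>.\<close>

lemma odd_irreducible_prime_factor:
  fixes p :: int
  assumes p: "prime p" "[p = 5] (mod 8)" and irr: "irreducible \<pi>" and dvd: "\<pi> dvd of_int p"
  shows "odd_irreducible \<pi>"
proof -
  have "odd p" using p(2) by (rule odd_of_cong_5_mod_8)
  moreover have "2 dvd p" if "(1 + gauss_i) dvd \<pi>"
  proof -
    have "gauss_norm (1 + gauss_i) = 2" by (simp add: gauss_norm_def gauss_i_def)
    then show ?thesis
      using gauss_norm_dvd [OF that] gauss_norm_prime_factor [OF assms] by simp
  qed
  ultimately show ?thesis using irr by (auto simp: odd_irreducible_def)
qed

section \<open>The four square roots modulo \<open>N\<close>\<close>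

lemma prime_not_dvd_message:
  assumes "m \<in> messages N" "prime p" "p dvd N"
  shows "\<not> p dvd m"
  using assms coprime_common_divisor [of m N p] not_prime_unit [of p]
  by (auto simp: messages_def)

lemma square_cong_prime_iff:
  fixes p z m :: int
  assumes "prime p"
  shows "[z\<^sup>2 = m\<^sup>2] (mod p) \<longleftrightarrow> [z = m] (mod p) \<or> [z = - m] (mod p)"
proof -
  have "z\<^sup>2 - m\<^sup>2 = (z - m) * (z - (- m))" by (simp add: power2_eq_square algebra_simps)
  then show ?thesis
    using assms by (simp only: cong_iff_dvd_diff prime_dvd_mult_iff)
qed

lemma uminus_cong_flip:
  fixes a b n :: int
  shows "[- a = b] (mod n) \<longleftrightarrow> [a = - b] (mod n)"
  using cong_minus_minus_iff [of "- a" b n] by simp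

lemma cong_bounded_eq:
  fixes a b n :: int
  assumes "[a = b] (mod n)" "0 < a" "a < n" "0 < b" "b < n"
  shows "a = b"
  using assms by (simp add: cong_def)

text \<open>The sign \<open>e\<close> is needed because matching the parity of \<open>m\<close> may force replacing the root
  \<open>w \<equiv> m (mod p)\<close> by \<open>N - w\<close>.\<close>

lemma square_roots_cipher:
  fixes p q N m :: int
  assumes p: "prime p" and q: "prime q" and pq: "p \<noteq> q" and op: "odd p" and oq: "odd q"
    and N: "N = p * q" and m: "m \<in> messages N"
  obtains w e where "square_roots N (rabin_cipher N m) = {m, N - m, w, N - w}"
    "w \<noteq> m" "w \<noteq> N - m" "w mod 2 = m mod 2" "e = 1 \<or> e = - 1"
    "[w = e * m] (mod p)" "[w = - e * m] (mod q)"
proof -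
  have cop: "coprime p q" using p q pq by (rule primes_coprime)
  have m0: "0 < m" "m < N" using m by (auto simp: messages_def)
  have pm: "\<not> p dvd m" and qm: "\<not> q dvd m"
    using prime_not_dvd_message [OF m] p q N by simp_all
  have two: "\<not> p dvd 2" "\<not> q dvd 2"
    using odd_prime_not_dvd_two p q op oq by blast+
  \<comment> \<open>Otherwise the prime would divide \<open>2 * m\<close>. This later separates
    \<open>w\<close> from \<open>m\<close>.\<close>
  have neg_p: "\<not> [m = - m] (mod p)" and neg_q: "\<not> [m = - m] (mod q)"
    using two pm qm prime_dvd_multD [OF p, of 2 m] prime_dvd_multD [OF q, of 2 m]
    by (auto simp: cong_iff_dvd_diff)
  have N0: "N > 0" "odd N" using N p q op oq prime_gt_0_int by auto
  obtain y where y: "[y = m] (mod p)" "[y = - m] (mod q)"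
    using binary_chinese_remainder_int [OF cop] by blast
  define x where "x = y mod N"
  have x: "[x = m] (mod p)" "[x = - m] (mod q)"
    using y by (simp_all add: x_def N cong_def mod_mod_cancel)
  have "\<not> p dvd x" using pm x(1) by (simp add: cong_dvd_iff)
  then have "x \<noteq> 0" by auto
  moreover have "0 \<le> x" "x < N" using N0 by (simp_all add: x_def)
  ultimately have x0: "0 < x" "x < N" by simp_all
  have Nx: "[N - x = - m] (mod p)" "[N - x = m] (mod q)"
    using x by (simp_all add: N cong_iff_dvd_diff algebra_simps)
      (metis add.commute add_diff_cancel_left' diff_diff_eq2 dvd_diff dvd_triv_left dvd_triv_right)+
  obtain w e where w: "w mod 2 = m mod 2" "0 < w" "w < N" "e = 1 \<or> e = - 1"
    "[w = e * m] (mod p)" "[w = - e * m] (mod q)"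
  proof (cases "x mod 2 = m mod 2")
    case True
    then show ?thesis using that [of x 1] x x0 by simp
  next
    case False
    then have "(N - x) mod 2 = m mod 2" using N0(2) by presburger
    then show ?thesis using that [of "N - x" "- 1"] Nx x0 by simp
  qed
  have roots: "z \<in> square_roots N (rabin_cipher N m) \<longleftrightarrow> z \<in> {m, N - m, w, N - w}" for z
  proof -
    have mod_sub: "(N - t) mod p = (- t) mod p" "(N - t) mod q = (- t) mod q" for t
      using cong_iff_dvd_diff [of "N - t" "- t"] by (simp_all add: N cong_def)
    have "(- w) mod p = (- (e * m)) mod p" "(- w) mod q = (e * m) mod q"
      using w(5,6) uminus_cong_flip [of w "e * m" q] cong_minus_minus_iff [of w "e * m" p]
      by (simp_all add: cong_def)
    \<comment> \<open>The disjuncts are the cases \<open>e = 1\<close> and \<open>e = - 1\<close>.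
      In each, \<open>m\<close>, \<open>- m\<close>, \<open>w\<close> and \<open>- w\<close> realize
      all four sign patterns of \<open>m\<close> modulo \<open>p\<close> and
      \<open>q\<close>.\<close>
    with w(4-6) have signs:
      "w mod p = m mod p \<and> (- w) mod p = (- m) mod p \<and> w mod q = (- m) mod q \<and> (- w) mod q = m mod q
      \<or> w mod p = (- m) mod p \<and> (- w) mod p = m mod p \<and> w mod q = m mod q \<and> (- w) mod q = (- m) mod q"
      by (auto simp: cong_def)
    \<comment> \<open>Uniqueness in the Chinese remainder theorem: between 0 and \<open>N\<close>,
      the residues modulo \<open>p\<close> and \<open>q\<close> determine a number.\<close>
    have eqI: "z = t" if "0 < z" "z < N" "0 < t" "t < N" "z mod p = t mod p" "z mod q = t mod q" for t
      using that coprime_cong_mult [of z t p q] cop cong_bounded_eq [of z t N] N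
      by (simp add: cong_def)
    have "z \<in> square_roots N (rabin_cipher N m) \<longleftrightarrow> 0 < z \<and> z < N \<and> [z\<^sup>2 = m\<^sup>2] (mod N)"
      by (simp add: square_roots_def rabin_cipher_def cong_def)
    also have "[z\<^sup>2 = m\<^sup>2] (mod N) \<longleftrightarrow> [z\<^sup>2 = m\<^sup>2] (mod p) \<and> [z\<^sup>2 = m\<^sup>2] (mod q)"
      unfolding N using cop coprime_cong_mult cong_modulus_mult cong_modulus_mult [of _ _ q p]
      by (metis mult.commute)
    also have "\<dots> \<longleftrightarrow> ([z = m] (mod p) \<or> [z = - m] (mod p)) \<and> ([z = m] (mod q) \<or> [z = - m] (mod q))"
      using square_cong_prime_iff p q by simp
    also have "0 < z \<and> z < N \<and> \<dots> \<longleftrightarrow> z \<in> {m, N - m, w, N - w}"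
    proof
      assume z: "0 < z \<and> z < N \<and>
        (([z = m] (mod p) \<or> [z = - m] (mod p)) \<and> ([z = m] (mod q) \<or> [z = - m] (mod q)))"
      then have "z mod p = m mod p \<or> z mod p = (- m) mod p"
        "z mod q = m mod q \<or> z mod q = (- m) mod q"
        by (auto simp: cong_def)
      moreover have "z mod p = m mod p \<Longrightarrow> z mod q = m mod q \<Longrightarrow> z = m"
        "z mod p = (- m) mod p \<Longrightarrow> z mod q = (- m) mod q \<Longrightarrow> z = N - m"
        "z mod p = w mod p \<Longrightarrow> z mod q = w mod q \<Longrightarrow> z = w"
        "z mod p = (- w) mod p \<Longrightarrow> z mod q = (- w) mod q \<Longrightarrow> z = N - w"
        using z w(2,3) m0 eqI [of m] eqI [of "N - m"] eqI [of w] eqI [of "N - w"]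
        by (simp_all only: mod_sub)
      ultimately have "z = m \<or> z = N - m \<or> z = w \<or> z = N - w"
        using signs by metis
      then show "z \<in> {m, N - m, w, N - w}" by simp
    next
      assume "z \<in> {m, N - m, w, N - w}"
      then show "0 < z \<and> z < N \<and>
        (([z = m] (mod p) \<or> [z = - m] (mod p)) \<and> ([z = m] (mod q) \<or> [z = - m] (mod q)))"
        using w(2,3) m0 signs by (auto simp: cong_def mod_sub)
    qed
    finally show ?thesis .
  qed
  \<comment> \<open>Equality would give \<open>[m = - m]\<close> modulo \<open>q\<close> if
    \<open>e = 1\<close>, and modulo \<open>p\<close> if \<open>e = - 1\<close>.\<close>
  have "w \<noteq> m"
    using w(4-6) neg_p neg_q by auto
  moreover have "w \<noteq> N - m" using w(1) N0(2) by presburger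
  ultimately show ?thesis using that [of w e] roots w by blast
qed

lemma parity_complement:
  fixes N m :: int
  assumes "odd N"
  shows "(N - m) mod 2 \<noteq> m mod 2"
  using assms by presburger

section \<open>Recovering the message from the ciphertext and the two bits\<close>

theorem mainTheorem2:
  fixes p q N :: int and \<pi>1 \<pi>2 \<nu> :: gauss_int
  assumes "prime p" and "prime q" and "p \<noteq> q"
    and "[p = 5] (mod 8)" and "[q = 5] (mod 8)"
    and "N = p * q"
    and "irreducible \<pi>1" and "primary \<pi>1" and "\<pi>1 dvd of_int p"
    and "irreducible \<pi>2" and "primary \<pi>2" and "\<pi>2 dvd of_int q"
    and "\<nu> = \<pi>1 * \<pi>2"
  shows "inj_on (\<lambda>m. (rabin_cipher N m, parity_bit m, quartic_bit \<nu> m)) (messages N) \<and>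
    (\<forall>m \<in> messages N.
      card (square_roots N (rabin_cipher N m)) = 4 \<and>
      card {z \<in> square_roots N (rabin_cipher N m). parity_bit z = parity_bit m} = 2 \<and>
      {z \<in> square_roots N (rabin_cipher N m).
         parity_bit z = parity_bit m \<and> quartic_bit \<nu> z = quartic_bit \<nu> m} = {m})"
proof -
  note p = \<open>prime p\<close> \<open>[p = 5] (mod 8)\<close> and q = \<open>prime q\<close> \<open>[q = 5] (mod 8)\<close>
  note fp = p \<open>irreducible \<pi>1\<close> \<open>\<pi>1 dvd of_int p\<close>
  note fq = q \<open>irreducible \<pi>2\<close> \<open>\<pi>2 dvd of_int q\<close>
  have op: "odd p" and oq: "odd q"
    using p(2) q(2) odd_of_cong_5_mod_8 by simp_all
  then have oN: "odd N" using \<open>N = p * q\<close> by simp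
  have symbol2: "quartic_symbol2 \<alpha> \<nu> = quartic_symbol \<alpha> \<pi>1 * quartic_symbol \<alpha> \<pi>2" for \<alpha>
    unfolding \<open>\<nu> = \<pi>1 * \<pi>2\<close>
    by (intro quartic_symbol2_mult odd_irreducible_prime_factor [OF fp]
        odd_irreducible_prime_factor [OF fq])
  have main: "card (square_roots N (rabin_cipher N m)) = 4 \<and>
      card {z \<in> square_roots N (rabin_cipher N m). parity_bit z = parity_bit m} = 2 \<and>
      {z \<in> square_roots N (rabin_cipher N m).
         parity_bit z = parity_bit m \<and> quartic_bit \<nu> z = quartic_bit \<nu> m} = {m}"
    if m: "m \<in> messages N" for m
  proof -
    obtain w e where roots: "square_roots N (rabin_cipher N m) = {m, N - m, w, N - w}"
      and w: "w \<noteq> m" "w \<noteq> N - m" "w mod 2 = m mod 2"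
      and e: "e = 1 \<or> e = - 1" "[w = e * m] (mod p)" "[w = - e * m] (mod q)"
      using square_roots_cipher [OF p(1) q(1) \<open>p \<noteq> q\<close> op oq \<open>N = p * q\<close> m] by metis
    have pm: "\<not> p dvd m" and qm: "\<not> q dvd m"
      using prime_not_dvd_message [OF m] p(1) q(1) \<open>N = p * q\<close> by simp_all
    have parity: "parity_bit w = parity_bit m" "parity_bit (N - m) \<noteq> parity_bit m"
      "parity_bit (N - w) \<noteq> parity_bit m"
      using w(3) parity_complement [OF oN, of m] parity_complement [OF oN, of w]
      by (simp_all add: parity_bit_def)
    let ?s = "quartic_symbol2 (of_int m) \<nu>"
    have "quartic_symbol (of_int m) \<pi>1 \<in> gauss_units" "quartic_symbol (of_int m) \<pi>2 \<in> gauss_units"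
      using quartic_symbol_eq_iff [OF fp pm] quartic_symbol_eq_iff [OF fq qm] by blast+
    then have s: "?s \<in> gauss_units"
      unfolding symbol2 by (auto simp: gauss_units_def gauss_i_square)
    \<comment> \<open>For \<open>e = 1\<close> the factor modulo \<open>\<pi>2\<close> changes sign,
      for \<open>e = - 1\<close> the factor modulo \<open>\<pi>1\<close>.\<close>
    have "quartic_symbol2 (of_int w) \<nu> = - ?s"
      using e
    proof (elim disjE)
      assume "e = 1"
      with e have "[w = m] (mod p)" "[w = - m] (mod q)" by simp_all
      then show ?thesis
        using quartic_symbol_cong [OF fp pm, of w] quartic_symbol_cong [OF fq, of "- m" w]
          quartic_symbol_uminus [OF fq qm] qm
        by (simp add: symbol2)
    next
      assume "e = - 1"
      with e have "[w = - m] (mod p)" "[w = m] (mod q)" by simp_all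
      then show ?thesis
        using quartic_symbol_cong [OF fq qm, of w] quartic_symbol_cong [OF fp, of "- m" w]
          quartic_symbol_uminus [OF fp pm] pm
        by (simp add: symbol2)
    qed
    \<comment> \<open>Negation exchanges 1 and i with -1 and -i. That \<open>?s\<close> is one of
      these units matters, since any other value would fall into the default case of the
      bit.\<close>
    then have bit: "quartic_bit \<nu> w \<noteq> quartic_bit \<nu> m"
      using s unfolding quartic_bit_def
      by (auto simp: gauss_units_def gauss_i_def gauss_int_eq_iff)
    \<comment> \<open>Parity separates \<open>m\<close> and \<open>w\<close> from their
      complements.\<close>
    have "m \<noteq> N - m" "w \<noteq> N - w" "m \<noteq> N - w" "N - m \<noteq> N - w"
      using parity w(1) by auto
    then have "card {m, N - m, w, N - w} = 4" using w by simp
    moreover have "{z \<in> {m, N - m, w, N - w}. parity_bit z = parity_bit m} = {m, w}"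
      using parity by auto
    moreover have "{z \<in> {m, N - m, w, N - w}.
        parity_bit z = parity_bit m \<and> quartic_bit \<nu> z = quartic_bit \<nu> m} = {m}"
      using parity bit by auto
    ultimately show ?thesis using roots w(1) by simp
  qed
  have "inj_on (\<lambda>m. (rabin_cipher N m, parity_bit m, quartic_bit \<nu> m)) (messages N)"
  proof (rule inj_onI)
    fix m n
    assume m: "m \<in> messages N" and n: "n \<in> messages N"
      and eq: "(rabin_cipher N m, parity_bit m, quartic_bit \<nu> m)
        = (rabin_cipher N n, parity_bit n, quartic_bit \<nu> n)"
    \<comment> \<open>With equal triples, \<open>m\<close> passes all the conditions that single out
      \<open>n\<close> among the roots for \<open>n\<close>.\<close>
    have "m \<in> square_roots N (rabin_cipher N m)"
      using m by (simp add: square_roots_def rabin_cipher_def messages_def cong_def)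
    then show "m = n" using main [OF n] eq by auto
  qed
  with main show ?thesis by blast
qed

end
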